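(* Let $b\ge 3$ be an integer and let $\{a_n\}_{n=0}^\infty$ be the $f$-sequence for the function $f(n)=\max\{1,n\bmod b\}$. For $n\ge1$ let the random variable $X_n$ denote the number of summands in the $b$-bin representation of an integer picked uniformly at random from $[0,a_{bn})$. Let $\mu_n$ and $\sigma_n$ be the mean and standard deviation of $X_n$, and let $Y_n=(X_n-\mu_n)/\sigma_n$. Then $Y_n$ converges in distribution to the standard normal distribution as $n\to\infty$.
   Context: $\mathbb{N}_0=\{0,1,2,\dots\}$. Given $f:\mathbb{N}_0\to\mathbb{N}_0$ and a sequence $\{a_n\}_{n=0}^\infty$, an $f$-decomposition of $x$ using $\{a_n\}$ is a finite sum $x=\sum_{i} a_{n_i}$ of terms with pairwise distinct indices $n_i\ge 0$, such that for every $a_{n_i}$ in the sum, the previous $f(n_i)$ terms $a_{n_i-f(n_i)},\dots,a_{n_i-1}$ (those with index $\ge 0$) are not in the sum. The $f$-sequence is the unique increasing sequence of positive integers such that every positive integer has a unique $f$-decomposition; explicitly $a_n=1$ for $n<1$ and $a_n=a_{n-1}+a_{n-1-f(n-1)}$ for $n\ge 1$. For an integer $b\geq 3$ let $f$ be the $b$-periodic function with values $1,1,2,\dots,b-1,\,1,1,2,\dots,b-1,\dots$, i.e. $f(n)=\max\{1,n\bmod b\}$ with $n \bmod b\in\{0,\dots,b-1\}$. The $b$-bin representation of $x$ is its unique $f$-decomposition for this $f$, using the $f$-sequence; the integer $0$ has the empty decomposition (zero summands). *)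

theory Defs
  imports "HOL-Probability.Probability"
begin

text \<open>
  A decomposition is identified with its finite set of indices. The condition \<open>m < n \<and> n \<le> m + f n\<close>
  says \<open>n - f n \<le> m < n\<close> without truncated subtraction.
\<close>

definition f_decomposition :: "(nat \<Rightarrow> nat) \<Rightarrow> (nat \<Rightarrow> nat) \<Rightarrow> nat \<Rightarrow> nat set \<Rightarrow> bool" where
  "f_decomposition f a x S \<longleftrightarrow>
     finite S \<and> x = (\<Sum>i\<in>S. a i) \<and> (\<forall>n\<in>S. \<forall>m. m < n \<and> n \<le> m + f n \<longrightarrow> m \<notin> S)"

definition is_f_sequence :: "(nat \<Rightarrow> nat) \<Rightarrow> (nat \<Rightarrow> nat) \<Rightarrow> bool" where
  "is_f_sequence f a \<longleftrightarrow>
     strict_mono a \<and> (\<forall>n. 0 < a n) \<and> (\<forall>x>0. \<exists>!S. f_decomposition f a x S)"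

definition num_summands :: "(nat \<Rightarrow> nat) \<Rightarrow> (nat \<Rightarrow> nat) \<Rightarrow> nat \<Rightarrow> nat" where
  "num_summands f a x = card (THE S. f_decomposition f a x S)"

definition bin_fun :: "nat \<Rightarrow> nat \<Rightarrow> nat" where
  "bin_fun b n = max 1 (n mod b)"

definition standardized :: "'a pmf \<Rightarrow> ('a \<Rightarrow> real) \<Rightarrow> 'a \<Rightarrow> real" where
  "standardized p X x =
     (X x - measure_pmf.expectation p X) / sqrt (measure_pmf.variance p X)"

lemma f_decomposition_zero_iff:
  assumes "\<And>n. 0 < a n"
  shows "f_decomposition f a 0 S \<longleftrightarrow> S = {}"
proof
  assume S: "f_decomposition f a 0 S"
  then have "finite S" "(\<Sum>i\<in>S. a i) = 0" by (auto simp: f_decomposition_def)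
  then have "\<forall>i\<in>S. a i = 0" by simp
  with assms show "S = {}" by (metis all_not_in_conv less_numeral_extra(3))
qed (auto simp: f_decomposition_def)

lemma f_decomposition_insert:
  assumes "f_decomposition f a y S" "\<forall>m\<in>S. m + f n < n"
  shows "f_decomposition f a (a n + y) (insert n S)"
proof -
  have n: "n \<notin> S" using assms(2) by auto
  have *: "k < n" if "k \<in> S" for k using assms(2) that by force
  show ?thesis
    unfolding f_decomposition_def
  proof (intro conjI ballI allI impI)
    show "finite (insert n S)" using assms(1) by (simp add: f_decomposition_def)
    show "a n + y = sum a (insert n S)" using assms(1) n by (simp add: f_decomposition_def)
  next
    fix k m assume k: "k \<in> insert n S" and m: "m < k \<and> k \<le> m + f k"
    show "m \<notin> insert n S"
    proof (cases "k = n")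
      case True
      then show ?thesis using m assms(2) by force
    next
      case False
      then have "k \<in> S" using k by simp
      then show ?thesis using m assms(1) *[of k] by (auto simp: f_decomposition_def)
    qed
  qed
qed

lemma f_decomposition_remove:
  assumes "f_decomposition f a x S" "n \<in> S" "S \<subseteq> {..n}"
  shows "f_decomposition f a (x - a n) (S - {n})" "a n \<le> x" "\<forall>m\<in>S - {n}. m + f n < n"
proof -
  have fin: "finite S" and x: "x = sum a S" using assms(1) by (auto simp: f_decomposition_def)
  have x2: "x = a n + sum a (S - {n})" using sum.remove[OF fin assms(2)] x by simp
  then show "a n \<le> x" by simp
  show "f_decomposition f a (x - a n) (S - {n})"
    using assms(1) x2 by (auto simp: f_decomposition_def)
  show "\<forall>m\<in>S - {n}. m + f n < n"
  proof
    fix m assume m: "m \<in> S - {n}"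
    then have "m < n" using assms(3) by force
    then show "m + f n < n" using m assms(1,2) by (auto simp: f_decomposition_def not_le[symmetric])
  qed
qed

lemma f_decomposition_index_le:
  assumes "f_decomposition f a x S" "i \<in> S"
  shows "a i \<le> x"
  using assms by (auto simp: f_decomposition_def intro: member_le_sum)

text \<open>The indices that may occur together with \<open>n\<close> below it are those smaller than \<open>n - f n\<close>;
  the truncated subtraction is harmless, as there are none when \<open>n \<le> f n\<close>.\<close>

lemma f_decompositions_below:
  assumes a0: "a 0 = 1"
    and rec: "\<And>k. k < n \<Longrightarrow> a (Suc k) = a k + (if f k \<le> k then a (k - f k) else 1)"
  shows "(\<exists>S\<subseteq>{..<n}. f_decomposition f a x S) \<longleftrightarrow> x < a n"
  using rec
proof (induction n arbitrary: x rule: less_induct)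
  case (less n)
  show ?case
  proof (cases n)
    case 0
    then show ?thesis using a0 by (auto simp: f_decomposition_def)
  next
    case (Suc k)
    have IH: "(\<exists>S\<subseteq>{..<m}. f_decomposition f a y S) \<longleftrightarrow> y < a m" if "m \<le> k" for m y
      using less.IH[of m y] less.prems that Suc by auto
    have top: "(\<exists>S\<subseteq>{..<k - f k}. f_decomposition f a y S) \<longleftrightarrow>
        y < (if f k \<le> k then a (k - f k) else 1)" for y
      using IH[of "k - f k" y] a0 by auto
    have below: "S \<subseteq> {..<k - f k} \<longleftrightarrow> (\<forall>m\<in>S. m + f k < k)" for S :: "nat set"
      by auto
    have "(\<exists>S\<subseteq>{..<n}. f_decomposition f a x S) \<longleftrightarrow>
        (\<exists>S\<subseteq>{..<k}. f_decomposition f a x S) \<or>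
        (a k \<le> x \<and> (\<exists>S\<subseteq>{..<k - f k}. f_decomposition f a (x - a k) S))" (is "?L \<longleftrightarrow> ?R1 \<or> ?R2")
    proof
      assume ?L
      then obtain S where S: "S \<subseteq> {..k}" "f_decomposition f a x S"
        unfolding Suc lessThan_Suc_atMost by blast
      show "?R1 \<or> ?R2"
      proof (cases "k \<in> S")
        case True
        then show ?thesis using f_decomposition_remove[OF S(2) True S(1)] below by blast
      next
        case False
        then have "S \<subseteq> {..<k}" using S(1) by (force simp: order.order_iff_strict)
        then show ?thesis using S(2) by blast
      qed
    next
      assume "?R1 \<or> ?R2"
      then show ?L
      proof
        assume ?R1
        then show ?L using Suc by (metis lessThan_subset_iff order.trans lessI less_imp_le)
      next
        assume ?R2
        then obtain S where S: "a k \<le> x" "S \<subseteq> {..<k - f k}" "f_decomposition f a (x - a k) S"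
          by blast
        have "f_decomposition f a x (insert k S)"
          using f_decomposition_insert[OF S(3), of k] S(1,2) below by simp
        moreover have "insert k S \<subseteq> {..<n}" using S(2) Suc by auto
        ultimately show ?L by blast
      qed
    qed
    also have "\<dots> \<longleftrightarrow> x < a n"
      unfolding IH[OF order.refl] top using less.prems[of k] Suc by auto
    finally show ?thesis .
  qed
qed

lemma f_decomposition_unique:
  assumes a0: "a 0 = 1"
    and rec: "\<And>k. a (Suc k) = a k + (if f k \<le> k then a (k - f k) else 1)"
    and "S \<subseteq> {..<n}" "T \<subseteq> {..<n}" "f_decomposition f a x S" "f_decomposition f a x T"
  shows "S = T"
  using assms(3-6)
proof (induction n arbitrary: x S T)
  case 0
  then show ?case by simp
next
  case (Suc n)
  have less: "x < a n" if "n \<notin> U" "U \<subseteq> {..<Suc n}" "f_decomposition f a x U" for U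
  proof -
    have "U \<subseteq> {..<n}" using that(1,2) unfolding lessThan_Suc by blast
    then show ?thesis using f_decompositions_below[OF a0 rec] that(3) by blast
  qed
  have ge: "a n \<le> x" if "n \<in> U" "f_decomposition f a x U" for U
    using f_decomposition_index_le that by blast
  have sub: "U - {n} \<subseteq> {..<n}" if "U \<subseteq> {..<Suc n}" for U
    using that unfolding lessThan_Suc by blast
  show ?case
  proof (cases "n \<in> S")
    case True
    then have T: "n \<in> T" using less[of T] ge[of S] Suc.prems(2-4) by (meson not_le)
    have "f_decomposition f a (x - a n) (S - {n})" "f_decomposition f a (x - a n) (T - {n})"
      using f_decomposition_remove(1) Suc.prems True T unfolding lessThan_Suc_atMost by blast+
    then have "S - {n} = T - {n}" using Suc.IH sub Suc.prems(1,2) by metis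
    then show ?thesis using True T by blast
  next
    case False
    then have T: "n \<notin> T" using less[of S] ge[of T] Suc.prems(1,3,4) by (meson not_le)
    then have "S \<subseteq> {..<n}" "T \<subseteq> {..<n}" using False sub Suc.prems(1,2) by blast+
    then show ?thesis using Suc.IH Suc.prems(3,4) by blast
  qed
qed

text \<open>The explicit form of the \<open>f\<close>-sequence, with the value 1 at negative indices. It shows that
  \<^const>\<open>is_f_sequence\<close> determines the sequence uniquely and is satisfiable for every \<open>f\<close>.\<close>

lemma is_f_sequence_iff_recurrence:
  "is_f_sequence f a \<longleftrightarrow>
     a 0 = 1 \<and> (\<forall>n. a (Suc n) = a n + (if f n \<le> n then a (n - f n) else 1))"
proof
  assume "is_f_sequence f a"
  then have mono: "strict_mono a" and pos: "\<And>n. 0 < a n"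
    and ex1: "\<And>x. 0 < x \<Longrightarrow> \<exists>!S. f_decomposition f a x S"
    by (auto simp: is_f_sequence_def)
  have ex: "\<exists>S\<subseteq>{..<n}. f_decomposition f a x S" if "x < a n" for x n
  proof -
    obtain S where S: "f_decomposition f a x S"
      using ex1[of x] f_decomposition_zero_iff[of a f, OF pos] by (cases "x = 0") auto
    have "i < n" if "i \<in> S" for i
      using f_decomposition_index_le[OF S that] \<open>x < a n\<close> mono
      by (meson le_less_trans strict_mono_less)
    then show ?thesis using S by blast
  qed
  have self: "\<not> (\<exists>S\<subseteq>{..<n}. f_decomposition f a (a n) S)" for n
  proof
    assume "\<exists>S\<subseteq>{..<n}. f_decomposition f a (a n) S"
    moreover have "f_decomposition f a (a n) {n}" by (auto simp: f_decomposition_def)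
    ultimately show False using ex1[OF pos[of n]] by auto
  qed
  have a0: "a 0 = 1"
  proof (rule ccontr)
    assume "a 0 \<noteq> 1"
    then have "1 < a 0" using pos[of 0] by linarith
    from ex[OF this] show False by (auto simp: f_decomposition_def)
  qed
  have rec: "a (Suc n) = a n + (if f n \<le> n then a (n - f n) else 1)" for n
  proof (induction n rule: less_induct)
    case (less n)
    define a' where "a' = a(Suc n := a n + (if f n \<le> n then a (n - f n) else 1))"
    have eq: "f_decomposition f a' x S \<longleftrightarrow> f_decomposition f a x S" if "S \<subseteq> {..<Suc n}" for x S
    proof -
      have "sum a' S = sum a S" using that by (intro sum.cong) (auto simp: a'_def)
      then show ?thesis by (simp add: f_decomposition_def)
    qed
    have "(\<exists>S\<subseteq>{..<Suc n}. f_decomposition f a' x S) \<longleftrightarrow> x < a' (Suc n)" for x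
    proof (rule f_decompositions_below)
      show "a' 0 = 1" using a0 by (simp add: a'_def)
      show "a' (Suc k) = a' k + (if f k \<le> k then a' (k - f k) else 1)" if "k < Suc n" for k
      proof -
        have "k - f k \<noteq> Suc n" using that by linarith
        then show ?thesis using less[of k] that by (cases "k = n") (auto simp: a'_def)
      qed
    qed
    then have *: "(\<exists>S\<subseteq>{..<Suc n}. f_decomposition f a x S) \<longleftrightarrow> x < a' (Suc n)" for x
      using eq by blast
    have "\<not> a (Suc n) < a' (Suc n)" using * self by blast
    moreover have "\<not> a' (Suc n) < a (Suc n)" using * ex by blast
    ultimately show ?case by (simp add: a'_def)
  qed
  show "a 0 = 1 \<and> (\<forall>n. a (Suc n) = a n + (if f n \<le> n then a (n - f n) else 1))"
    using a0 rec by blast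
next
  assume "a 0 = 1 \<and> (\<forall>n. a (Suc n) = a n + (if f n \<le> n then a (n - f n) else 1))"
  then have a0: "a 0 = 1"
    and rec: "\<And>n. a (Suc n) = a n + (if f n \<le> n then a (n - f n) else 1)" by auto
  have pos: "0 < a n" for n
    by (induction n) (simp_all add: a0 rec)
  have mono: "strict_mono a"
    by (rule strict_monoI_Suc) (simp add: rec pos)
  have "\<exists>!S. f_decomposition f a x S" for x
  proof -
    have "x < a (Suc x)"
      using strict_mono_imp_increasing[OF mono, of "Suc x"] by simp
    then obtain S where S: "f_decomposition f a x S"
      using f_decompositions_below[OF a0 rec] by blast
    have "T = S" if "f_decomposition f a x T" for T
    proof -
      have "finite (S \<union> T)" using S that by (simp add: f_decomposition_def)
      then obtain n where "S \<union> T \<subseteq> {..<n}" using finite_nat_iff_bounded by blast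
      then show ?thesis using f_decomposition_unique[OF a0 rec _ _ that S, of n] by blast
    qed
    with S show ?thesis by blast
  qed
  with mono pos show "is_f_sequence f a" by (simp add: is_f_sequence_def)
qed

end

theory Submission
  imports Defs
begin

text \<open>
  Cut the indices into bins \<open>{b * k, \<dots>, b * k + b - 1}\<close>. An index that is not the lowest of its bin
  excludes everything below it in the bin, and the lowest index excludes only its predecessor, the
  top of the preceding bin. So a decomposition chooses at most one index in each bin, and the only
  other restriction is that the top of a bin and the bottom of the next one are not both chosen.
  If \<open>G\<^sub>n(z)\<close> denotes the generating function of the number of summands over the integers below
  \<open>a (b * n)\<close>, then counting by the last bin gives
  \<open>G\<^sub>n\<^sub>+\<^sub>2 = (1 + b z) G\<^sub>n\<^sub>+\<^sub>1 - z\<^sup>2 G\<^sub>n\<close> (lemma \<open>bin_gf_recurrence\<close>).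

  This is the recurrence of the Chebyshev polynomials of the second kind, whose roots are
  explicit. Hence (lemma \<open>bin_gf_factors\<close>)
  \<open>G\<^sub>n(z) = (\<Prod>j = 1..n. 1 + c\<^sub>j z)\<close> with \<open>c\<^sub>j = b - 2 cos (j \<pi> / (n + 1))\<close>.
  For \<open>b \<ge> 3\<close> all \<open>c\<^sub>j\<close> are at least 1, so \<open>G\<^sub>n(z) / G\<^sub>n(1)\<close> is the product of the generating functions
  \<open>1 - p\<^sub>j + p\<^sub>j z\<close> of Bernoulli variables with \<open>p\<^sub>j = c\<^sub>j / (1 + c\<^sub>j)\<close>: the number of summands is
  distributed exactly like a sum of \<open>n\<close> independent indicators. Since \<open>1 \<le> c\<^sub>j \<le> b + 2\<close>, each of
  them has a variance bounded below in terms of \<open>b\<close>, and the total variance tends to infinity.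

  That is all the central limit theorem needs for a triangular array of independent indicators
  (theorem \<open>poisson_binomial_clt\<close>). Its characteristic function is a product that is compared
  factor by factor with \<open>exp (- t\<^sup>2 / 2)\<close>; because a centred indicator is bounded by 1, the error
  of each factor is proportional to its variance, and the errors add up to \<open>O(1 / \<sigma>)\<close>.
  Levy's continuity theorem then gives convergence in distribution.
\<close>

section \<open>Sums of independent indicators, described by their generating function\<close>

text \<open>
  The law of a sum of independent indicators with success probabilities \<open>p j\<close>. Fixing the law through
  its generating function avoids realising the indicators themselves: the counted quantity has no
  visible independent parts, only a generating function that happens to split.
\<close>

locale poisson_binomial =
  fixes P :: "'a pmf" and N :: "'a \<Rightarrow> nat" and J :: "'i set" and p :: "'i \<Rightarrow> real"
  assumes finite_support: "finite (set_pmf P)"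
    and finite_index: "finite J"
    and prob_bounds: "\<And>j. j \<in> J \<Longrightarrow> 0 \<le> p j \<and> p j \<le> 1"
    and pgf: "\<And>z::complex. measure_pmf.expectation P (\<lambda>x. z ^ N x) =
      (\<Prod>j\<in>J. 1 - of_real (p j) + of_real (p j) * z)"
begin

lemma integrable_on_support [simp]:
  "integrable (measure_pmf P) (f :: 'a \<Rightarrow> 'b :: {banach, second_countable_topology})"
  by (rule integrable_measure_pmf_finite[OF finite_support])

lemma expectation_eq_sum:
  fixes f :: "'a \<Rightarrow> 'b :: {banach, second_countable_topology}"
  shows "measure_pmf.expectation P f = (\<Sum>x\<in>set_pmf P. pmf P x *\<^sub>R f x)"
  by (rule integral_measure_pmf[OF finite_support])

lemma pgf_real:
  fixes y :: real
  shows "measure_pmf.expectation P (\<lambda>x. y ^ N x) = (\<Prod>j\<in>J. 1 - p j + p j * y)"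
proof -
  have "complex_of_real (measure_pmf.expectation P (\<lambda>x. y ^ N x)) =
      measure_pmf.expectation P (\<lambda>x. complex_of_real y ^ N x)"
    by (simp flip: integral_complex_of_real)
  also have "\<dots> = complex_of_real (\<Prod>j\<in>J. 1 - p j + p j * y)"
    by (simp add: pgf)
  finally show ?thesis
    by (simp only: of_real_eq_iff)
qed

lemma expectation_has_derivative:
  fixes y :: real
  shows "((\<lambda>y. measure_pmf.expectation P (\<lambda>x. c x * y ^ k x)) has_real_derivative
     measure_pmf.expectation P (\<lambda>x. c x * (real (k x) * y ^ (k x - 1)))) (at y)"
  unfolding expectation_eq_sum by (auto intro!: derivative_eq_intros sum.cong)

text \<open>
  The moments are read off from the generating function \<open>g\<close> at 1: its first two derivatives there
  are the expectations of \<open>N\<close> and \<open>N (N - 1)\<close>. For a product these are easiest through the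
  logarithmic derivative \<open>L\<close>, as \<open>g' = g L\<close> and \<open>g'' = g L\<^sup>2 + g L'\<close>; at 1 the values are
  \<open>g = 1\<close>, \<open>L = \<Sum>p\<close> and \<open>L' = - \<Sum>p\<^sup>2\<close>.
\<close>

lemma mean_and_variance:
  shows mean: "measure_pmf.expectation P (\<lambda>x. real (N x)) = (\<Sum>j\<in>J. p j)"
    and variance: "measure_pmf.variance P (\<lambda>x. real (N x)) = (\<Sum>j\<in>J. p j * (1 - p j))"
proof -
  define g where "g = (\<lambda>y::real. \<Prod>j\<in>J. 1 - p j + p j * y)"
  define L where "L = (\<lambda>y::real. \<Sum>j\<in>J. p j / (1 - p j + p j * y))"
  have nz: "1 - p j + p j * y \<noteq> 0" if "j \<in> J" "0 < y" for j y
  proof (cases "p j = 1")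
    case True
    then show ?thesis using that by simp
  next
    case False
    then have "0 < 1 - p j" "0 \<le> p j * y"
      using prob_bounds[OF that(1)] that(2) by auto
    then show ?thesis by linarith
  qed
  have g': "(g has_real_derivative g y * L y) (at y)" if "0 < y" for y
    unfolding g_def L_def
    by (rule has_field_derivative_prod') (use nz that in \<open>auto intro!: derivative_eq_intros\<close>)
  have L': "(L has_real_derivative (\<Sum>j\<in>J. - (p j)\<^sup>2)) (at 1)"
    unfolding L_def by (auto intro!: derivative_eq_intros sum.cong simp: power2_eq_square)
  have first: "measure_pmf.expectation P (\<lambda>x. real (N x) * y ^ (N x - 1)) = g y * L y"
    if "0 < y" for y
  proof (rule DERIV_unique)
    show "((\<lambda>y. measure_pmf.expectation P (\<lambda>x. y ^ N x)) has_real_derivative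
        measure_pmf.expectation P (\<lambda>x. real (N x) * y ^ (N x - 1))) (at y)"
      using expectation_has_derivative[of "\<lambda>_. 1" N y] by simp
    show "((\<lambda>y. measure_pmf.expectation P (\<lambda>x. y ^ N x)) has_real_derivative g y * L y) (at y)"
      using g'[OF that] by (simp add: pgf_real g_def)
  qed
  have second: "measure_pmf.expectation P (\<lambda>x. real (N x) * real (N x - 1)) =
      g 1 * L 1 * L 1 + (\<Sum>j\<in>J. - (p j)\<^sup>2) * g 1"
  proof (rule DERIV_unique)
    let ?E = "\<lambda>y. measure_pmf.expectation P (\<lambda>x. real (N x) * y ^ (N x - 1))"
    show "(?E has_real_derivative measure_pmf.expectation P (\<lambda>x. real (N x) * real (N x - 1))) (at 1)"
      using expectation_has_derivative[of "\<lambda>x. real (N x)" "\<lambda>x. N x - 1" 1] by simp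
    have "((\<lambda>y. g y * L y) has_real_derivative
        g 1 * L 1 * L 1 + (\<Sum>j\<in>J. - (p j)\<^sup>2) * g 1) (at 1)"
      by (rule DERIV_mult[OF g' L']) simp
    then show "(?E has_real_derivative g 1 * L 1 * L 1 + (\<Sum>j\<in>J. - (p j)\<^sup>2) * g 1) (at 1)"
      by (rule has_field_derivative_transform_within_open[where S = "{0<..}"])
        (use first in auto)
  qed
  have at1: "g 1 = 1" "L 1 = (\<Sum>j\<in>J. p j)"
    by (simp_all add: g_def L_def)
  show mean: "measure_pmf.expectation P (\<lambda>x. real (N x)) = (\<Sum>j\<in>J. p j)"
    using first[of 1] at1 by simp
  have "(real (N x))\<^sup>2 = real (N x) * real (N x - 1) + real (N x)" for x
    by (cases "N x") (auto simp: power2_eq_square algebra_simps)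
  then have "measure_pmf.expectation P (\<lambda>x. (real (N x))\<^sup>2) =
      measure_pmf.expectation P (\<lambda>x. real (N x) * real (N x - 1)) + (\<Sum>j\<in>J. p j)"
    by (simp add: mean)
  then have "measure_pmf.expectation P (\<lambda>x. (real (N x))\<^sup>2) =
      (\<Sum>j\<in>J. p j)\<^sup>2 - (\<Sum>j\<in>J. (p j)\<^sup>2) + (\<Sum>j\<in>J. p j)"
    unfolding second at1 by (simp add: power2_eq_square sum_negf)
  then show "measure_pmf.variance P (\<lambda>x. real (N x)) = (\<Sum>j\<in>J. p j * (1 - p j))"
    by (subst measure_pmf.variance_eq)
      (simp_all add: mean power2_eq_square right_diff_distrib sum_subtractf)
qed

end

section \<open>The central limit theorem for such sums\<close>

lemma bernoulli_char_le_1: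
  assumes "0 \<le> p" "p \<le> 1"
  shows "cmod (of_real (1 - p) * iexp (- (s * p)) + of_real p * iexp (s * (1 - p))) \<le> 1"
proof -
  have "cmod (of_real (1 - p) * iexp (- (s * p)) + of_real p * iexp (s * (1 - p))) \<le>
      cmod (of_real (1 - p) * iexp (- (s * p))) + cmod (of_real p * iexp (s * (1 - p)))"
    by (rule norm_triangle_ineq)
  also have "\<dots> = (1 - p) + p"
    using assms by (simp only: norm_mult norm_exp_i_times norm_of_real) simp
  finally show ?thesis by simp
qed

lemma iexp_quadratic_approx:
  "cmod (iexp x - (1 + \<i> * of_real x - of_real (x\<^sup>2 / 2))) \<le> \<bar>x\<bar> ^ 3 / 6"
  using iexp_approx1[of x 2] by (simp add: numeral_eq_Suc field_simps)

text \<open>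
  The upper bound comes from \<open>(1 - u + u\<^sup>2 / 2) (1 + u + u\<^sup>2 / 2) = 1 + u\<^sup>4 / 4 \<ge> 1\<close> together with
  \<open>1 + u + u\<^sup>2 / 2 \<le> exp u\<close>.
\<close>

lemma exp_minus_quadratic_approx:
  fixes u :: real
  assumes "0 \<le> u"
  shows "\<bar>exp (- u) - (1 - u)\<bar> \<le> u\<^sup>2 / 2"
proof -
  have "exp (- u) * (1 + u + u\<^sup>2 / 2) \<le> exp (- u) * exp u"
    using exp_lower_Taylor_quadratic[OF assms] by (intro mult_left_mono) auto
  also have "\<dots> = 1" by (simp flip: exp_add)
  also have "1 \<le> 1 + u ^ 4 / 4" by simp
  also have "\<dots> = (1 - u + u\<^sup>2 / 2) * (1 + u + u\<^sup>2 / 2)"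
    by (simp add: field_simps power2_eq_square power4_eq_xxxx)
  finally have "exp (- u) \<le> 1 - u + u\<^sup>2 / 2"
    by (rule mult_right_le_imp_le) (use assms in \<open>simp add: add_pos_nonneg\<close>)
  moreover have "1 - u \<le> exp (- u)"
    using exp_ge_add_one_self[of "- u"] by simp
  ultimately show ?thesis by simp
qed

text \<open>
  A centred indicator takes the value \<open>- p\<close> with probability \<open>1 - p\<close> and \<open>1 - p\<close> with probability
  \<open>p\<close>, so the left-hand side compares its characteristic function with that of a normal variable of
  the same variance \<open>p (1 - p)\<close>. Both agree to second order. The point of the bound is its factor
  \<open>p (1 - p)\<close>: summed over many indicators, it produces the total variance instead of their number.
\<close>

lemma bernoulli_char_approx:
  fixes p s :: real
  assumes "0 \<le> p" "p \<le> 1"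
  shows "cmod (of_real (1 - p) * iexp (- (s * p)) + of_real p * iexp (s * (1 - p))
      - of_real (exp (- (s\<^sup>2 * (p * (1 - p)) / 2)))) \<le> (\<bar>s\<bar> ^ 3 / 6 + s ^ 4 / 8) * (p * (1 - p))"
proof -
  define q where "q = p * (1 - p)"
  have q: "0 \<le> q" "q \<le> 1"
    using assms by (auto simp: q_def intro: mult_le_one)
  \<comment> \<open>\<open>A\<close> and \<open>B\<close> are the Taylor errors at the two values of the indicator, \<open>C\<close> that of the normal
    factor; the Taylor polynomials themselves cancel because the linear terms average to 0.\<close>
  define T where "T = (\<lambda>x. 1 + \<i> * complex_of_real x - of_real (x\<^sup>2 / 2))"
  define A where "A = of_real (1 - p) * (iexp (- (s * p)) - T (- (s * p)))"
  define B where "B = of_real p * (iexp (s * (1 - p)) - T (s * (1 - p)))"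
  define C where "C = complex_of_real (1 - s\<^sup>2 * q / 2 - exp (- (s\<^sup>2 * q / 2)))"
  have "of_real (1 - p) * T (- (s * p)) + of_real p * T (s * (1 - p)) = of_real (1 - s\<^sup>2 * q / 2)"
    by (simp add: T_def q_def complex_eq_iff) (simp add: field_simps power2_eq_square)
  then have eq: "of_real (1 - p) * iexp (- (s * p)) + of_real p * iexp (s * (1 - p))
      - of_real (exp (- (s\<^sup>2 * q / 2))) = A + B + C"
    by (simp add: A_def B_def C_def algebra_simps)
  have "cmod A \<le> (1 - p) * (\<bar>- (s * p)\<bar> ^ 3 / 6)"
    unfolding A_def T_def norm_mult norm_of_real using assms
    by (intro mult_mono iexp_quadratic_approx) auto
  also have "\<dots> = \<bar>s\<bar> ^ 3 / 6 * (q * p\<^sup>2)"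
    using assms by (simp add: q_def abs_mult power_mult_distrib power2_eq_square power3_eq_cube)
  finally have A: "cmod A \<le> \<bar>s\<bar> ^ 3 / 6 * (q * p\<^sup>2)" .
  have "cmod B \<le> p * (\<bar>s * (1 - p)\<bar> ^ 3 / 6)"
    unfolding B_def T_def norm_mult norm_of_real using assms
    by (intro mult_mono iexp_quadratic_approx) auto
  also have "\<dots> = \<bar>s\<bar> ^ 3 / 6 * (q * (1 - p)\<^sup>2)"
    using assms by (simp add: q_def abs_mult power_mult_distrib power2_eq_square power3_eq_cube)
  finally have B: "cmod B \<le> \<bar>s\<bar> ^ 3 / 6 * (q * (1 - p)\<^sup>2)" .
  have "p\<^sup>2 + (1 - p)\<^sup>2 \<le> 1"
    using q(1) by (simp add: q_def power2_eq_square algebra_simps)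
  then have "\<bar>s\<bar> ^ 3 / 6 * q * (p\<^sup>2 + (1 - p)\<^sup>2) \<le> \<bar>s\<bar> ^ 3 / 6 * q * 1"
    using q(1) by (intro mult_left_mono) auto
  then have AB: "\<bar>s\<bar> ^ 3 / 6 * (q * p\<^sup>2) + \<bar>s\<bar> ^ 3 / 6 * (q * (1 - p)\<^sup>2) \<le> \<bar>s\<bar> ^ 3 / 6 * q"
    by (simp add: algebra_simps)
  have "cmod C \<le> (s\<^sup>2 * q / 2)\<^sup>2 / 2"
    using exp_minus_quadratic_approx[of "s\<^sup>2 * q / 2"] q(1)
    unfolding C_def norm_of_real by (simp add: abs_minus_commute)
  also have "\<dots> = s ^ 4 / 8 * (q * q)"
    by (simp add: power2_eq_square power4_eq_xxxx)
  also have "\<dots> \<le> s ^ 4 / 8 * q"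
    using q by (intro mult_left_mono mult_left_le) auto
  finally have C: "cmod C \<le> s ^ 4 / 8 * q" .
  have "cmod (A + B + C) \<le> cmod A + cmod B + cmod C"
    by (meson norm_triangle_ineq norm_triangle_mono order_refl)
  also have "\<dots> \<le> (\<bar>s\<bar> ^ 3 / 6 + s ^ 4 / 8) * q"
    using A B C AB by (simp add: distrib_right)
  finally show ?thesis
    unfolding eq[symmetric] by (simp add: q_def)
qed

context poisson_binomial
begin

lemma char_standardized:
  defines "\<sigma> \<equiv> sqrt (\<Sum>j\<in>J. p j * (1 - p j))"
  shows "char (distr (measure_pmf P) borel (standardized P (\<lambda>x. real (N x)))) t =
    (\<Prod>j\<in>J. of_real (1 - p j) * iexp (- (t / \<sigma> * p j)) + of_real (p j) * iexp (t / \<sigma> * (1 - p j)))"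
proof -
  define s where "s = t / \<sigma>"
  have std: "standardized P (\<lambda>x. real (N x)) x = (real (N x) - (\<Sum>j\<in>J. p j)) / \<sigma>" for x
    unfolding standardized_def variance unfolding mean \<sigma>_def ..
  have "iexp (t * standardized P (\<lambda>x. real (N x)) x) =
      iexp (- (s * (\<Sum>j\<in>J. p j))) * iexp s ^ N x" for x
  proof -
    have "t * standardized P (\<lambda>x. real (N x)) x = real (N x) * s - s * (\<Sum>j\<in>J. p j)"
      by (simp add: std s_def diff_divide_distrib algebra_simps)
    then show ?thesis
      by (simp only:) (simp add: exp_of_nat_mult[symmetric] exp_add[symmetric] algebra_simps)
  qed
  then have "char (distr (measure_pmf P) borel (standardized P (\<lambda>x. real (N x)))) t =
      measure_pmf.expectation P (\<lambda>x. iexp (- (s * (\<Sum>j\<in>J. p j))) * iexp s ^ N x)"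
    unfolding char_def by (subst integral_distr) simp_all
  also have "\<dots> = iexp (- (s * (\<Sum>j\<in>J. p j))) *
      (\<Prod>j\<in>J. 1 - of_real (p j) + of_real (p j) * iexp s)"
    by (simp add: pgf)
  also have "iexp (- (s * (\<Sum>j\<in>J. p j))) = (\<Prod>j\<in>J. iexp (- (s * p j)))"
    by (simp add: exp_sum[OF finite_index, symmetric] sum_distrib_left sum_negf)
  also have "\<dots> * (\<Prod>j\<in>J. 1 - of_real (p j) + of_real (p j) * iexp s) =
      (\<Prod>j\<in>J. of_real (1 - p j) * iexp (- (s * p j)) + of_real (p j) * iexp (s * (1 - p j)))"
    unfolding prod.distrib[symmetric]
  proof (rule prod.cong[OF refl])
    fix j
    have "iexp (s * (1 - p j)) = iexp (- (s * p j)) * iexp s"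
      by (simp add: exp_add[symmetric] algebra_simps)
    then show "iexp (- (s * p j)) * (1 - of_real (p j) + of_real (p j) * iexp s) =
        of_real (1 - p j) * iexp (- (s * p j)) + of_real (p j) * iexp (s * (1 - p j))"
      by (simp only:) (simp add: algebra_simps)
  qed
  finally show ?thesis by (simp add: s_def)
qed

text \<open>
  A difference of two products of factors in the unit disc is at most the sum of the differences
  of the factors. With \<open>s = t / \<sigma>\<close> that sum is \<open>(\<bar>s\<bar>\<^sup>3 / 6 + s\<^sup>4 / 8) \<sigma>\<^sup>2\<close>, where \<open>\<sigma>\<^sup>2 = v\<close>.
\<close>

lemma char_standardized_approx:
  defines "v \<equiv> (\<Sum>j\<in>J. p j * (1 - p j))"
  assumes "0 < v"
  shows "cmod (char (distr (measure_pmf P) borel (standardized P (\<lambda>x. real (N x)))) t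
      - of_real (exp (- (t\<^sup>2) / 2))) \<le> \<bar>t\<bar> ^ 3 / 6 / sqrt v + t ^ 4 / 8 / v"
proof -
  define s where "s = t / sqrt v"
  let ?w = "\<lambda>j. complex_of_real (exp (- (s\<^sup>2 * (p j * (1 - p j)) / 2)))"
  have s2: "s\<^sup>2 * v = t\<^sup>2"
    using assms by (simp add: s_def power_divide)
  have "(\<Prod>j\<in>J. ?w j) = of_real (exp (\<Sum>j\<in>J. - (s\<^sup>2 * (p j * (1 - p j)) / 2)))"
    by (simp add: exp_sum[OF finite_index])
  also have "(\<Sum>j\<in>J. - (s\<^sup>2 * (p j * (1 - p j)) / 2)) = - (s\<^sup>2 * v) / 2"
    by (simp add: v_def sum_negf sum_distrib_left sum_divide_distrib)
  finally have w: "of_real (exp (- (t\<^sup>2) / 2)) = (\<Prod>j\<in>J. ?w j)"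
    unfolding s2 by simp
  have "cmod (char (distr (measure_pmf P) borel (standardized P (\<lambda>x. real (N x)))) t
      - of_real (exp (- (t\<^sup>2) / 2))) \<le> (\<Sum>j\<in>J. (\<bar>s\<bar> ^ 3 / 6 + s ^ 4 / 8) * (p j * (1 - p j)))"
    unfolding char_standardized v_def[symmetric] s_def[symmetric] w
    using prob_bounds
    by (intro order.trans[OF norm_prod_diff] sum_mono bernoulli_char_approx bernoulli_char_le_1)
      (simp_all del: of_real_diff)
  also have "\<dots> = \<bar>s\<bar> ^ 3 * v / 6 + s ^ 4 * v / 8"
    unfolding sum_distrib_left[symmetric] v_def[symmetric] by (simp add: algebra_simps)
  also have "s ^ 4 * v = t ^ 4 / v"
  proof -
    have "s ^ 4 * v * v = (s\<^sup>2 * v)\<^sup>2"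
      by (simp add: power2_eq_square power4_eq_xxxx)
    also have "\<dots> = t ^ 4"
      by (simp add: s2)
    finally show ?thesis
      using \<open>0 < v\<close> by (simp add: field_simps)
  qed
  also have "\<bar>s\<bar> ^ 3 * v = \<bar>t\<bar> ^ 3 / sqrt v"
  proof -
    have "\<bar>s\<bar> * sqrt v = \<bar>t\<bar>"
      using assms by (simp add: s_def)
    then have "\<bar>t\<bar> ^ 3 = \<bar>s\<bar> ^ 3 * (sqrt v * sqrt v) * sqrt v"
      by (metis power_mult_distrib power3_eq_cube mult.assoc)
    then show ?thesis
      using assms by simp
  qed
  finally show ?thesis by simp
qed

end

theorem poisson_binomial_clt:
  fixes P :: "nat \<Rightarrow> 'a pmf" and J :: "nat \<Rightarrow> 'i set"
  assumes pb: "\<And>n. poisson_binomial (P n) (N n) (J n) (p n)"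
    and var: "filterlim (\<lambda>n. \<Sum>j\<in>J n. p n j * (1 - p n j)) at_top sequentially"
  shows "weak_conv_m
    (\<lambda>n. distr (measure_pmf (P n)) borel (standardized (P n) (\<lambda>x. real (N n x))))
    std_normal_distribution"
proof (rule levy_continuity)
  show "real_distribution (distr (measure_pmf (P n)) borel (standardized (P n) (\<lambda>x. real (N n x))))" for n
    by (intro prob_space.real_distribution_distr prob_space_measure_pmf) simp
  show "real_distribution std_normal_distribution"
    by (rule real_dist_normal_dist)
  fix t :: real
  define v where "v = (\<lambda>n. \<Sum>j\<in>J n. p n j * (1 - p n j))"
  let ?c = "\<lambda>n. char (distr (measure_pmf (P n)) borel (standardized (P n) (\<lambda>x. real (N n x)))) t"
  have v: "filterlim v at_top sequentially"
    using var by (simp add: v_def)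
  have sv: "filterlim (\<lambda>n. sqrt (v n)) at_top sequentially"
    by (rule filterlim_compose[OF sqrt_at_top v])
  have "(\<lambda>n. \<bar>t\<bar> ^ 3 / 6 / sqrt (v n) + t ^ 4 / 8 / v n) \<longlonglongrightarrow> 0 + 0"
    by (intro tendsto_add real_tendsto_divide_at_top[OF tendsto_const] v sv)
  then have bound: "(\<lambda>n. \<bar>t\<bar> ^ 3 / 6 / sqrt (v n) + t ^ 4 / 8 / v n) \<longlonglongrightarrow> 0"
    by simp
  have "eventually (\<lambda>n. 0 < v n) sequentially"
    using v by (simp add: filterlim_at_top_dense)
  then have "eventually (\<lambda>n. norm (?c n - of_real (exp (- (t\<^sup>2) / 2))) \<le>
      \<bar>t\<bar> ^ 3 / 6 / sqrt (v n) + t ^ 4 / 8 / v n) sequentially"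
    by eventually_elim (unfold v_def, rule poisson_binomial.char_standardized_approx[OF pb])
  then have "(\<lambda>n. ?c n - of_real (exp (- (t\<^sup>2) / 2))) \<longlonglongrightarrow> 0"
    by (rule Lim_null_comparison[OF _ bound])
  then show "?c \<longlonglongrightarrow> char std_normal_distribution t"
    unfolding char_std_normal_distribution by (rule LIM_zero_cancel)
qed

section \<open>The Chebyshev recurrence\<close>

text \<open>
  These are the Chebyshev polynomials of the second kind \<open>U\<^sub>n\<close>, rescaled to be monic and
  homogenised: for \<open>v \<noteq> 0\<close>, the value at \<open>x\<close> is \<open>v\<^sup>n U\<^sub>n(x / (2 v))\<close>.
\<close>

fun chebyshev_poly :: "'a :: real_field \<Rightarrow> nat \<Rightarrow> 'a poly" where
  "chebyshev_poly v 0 = 1"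
| "chebyshev_poly v (Suc 0) = [:0, 1:]"
| "chebyshev_poly v (Suc (Suc n)) =
    [:0, 1:] * chebyshev_poly v (Suc n) - smult (v\<^sup>2) (chebyshev_poly v n)"

lemma chebyshev_poly_monic:
  "degree (chebyshev_poly v n) \<le> n \<and> coeff (chebyshev_poly v n) n = 1"
proof (induction v n rule: chebyshev_poly.induct)
  case (3 v n)
  then show ?case
    by (auto intro!: degree_diff_le degree_pCons_le[THEN order.trans] degree_smult_le[THEN order.trans]
        simp: coeff_eq_0)
qed auto

lemma chebyshev_poly_cos:
  fixes v :: "'a :: real_field"
  shows "poly (chebyshev_poly v n) (2 * v * of_real (cos \<theta>)) * of_real (sin \<theta>) =
    v ^ n * of_real (sin (real (Suc n) * \<theta>))"
proof (induction v n rule: chebyshev_poly.induct)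
  case (2 v)
  have "real (Suc (Suc 0)) * \<theta> = 2 * \<theta>" by simp
  then show ?case by (simp only: sin_double) simp
next
  case (3 v n)
  define x where "x = real (Suc (Suc n)) * \<theta>"
  have x: "real (Suc n) * \<theta> = x - \<theta>" "real (Suc (Suc (Suc n))) * \<theta> = x + \<theta>"
    by (simp_all add: x_def algebra_simps)
  \<comment> \<open>\<open>sin ((n + 1) \<theta>)\<close> satisfies the same recurrence in \<open>n\<close>, with \<open>2 cos \<theta>\<close> as coefficient.\<close>
  have "sin (x + \<theta>) = 2 * cos \<theta> * sin x - sin (x - \<theta>)"
    by (simp add: sin_add sin_diff)
  then have sin_add_eq: "of_real (sin (x + \<theta>)) =
      2 * of_real (cos \<theta>) * of_real (sin x) - (of_real (sin (x - \<theta>)) :: 'a)"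
    by (simp only: of_real_diff of_real_mult of_real_numeral)
  have "poly (chebyshev_poly v (Suc (Suc n))) (2 * v * of_real (cos \<theta>)) * of_real (sin \<theta>) =
      2 * v * of_real (cos \<theta>) *
        (poly (chebyshev_poly v (Suc n)) (2 * v * of_real (cos \<theta>)) * of_real (sin \<theta>))
      - v\<^sup>2 * (poly (chebyshev_poly v n) (2 * v * of_real (cos \<theta>)) * of_real (sin \<theta>))"
    by (simp add: left_diff_distrib mult.assoc)
  also have "\<dots> = 2 * v * of_real (cos \<theta>) * (v ^ Suc n * of_real (sin x))
      - v\<^sup>2 * (v ^ n * of_real (sin (x - \<theta>)))"
    by (simp only: 3 x x_def[symmetric])
  also have "\<dots> = v ^ Suc (Suc n) * of_real (sin (x + \<theta>))"
    by (simp only: sin_add_eq) (simp add: right_diff_distrib power2_eq_square)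
  finally show ?case by (simp only: x)
qed auto

text \<open>For \<open>j = 1, \<dots>, n\<close> these are the roots of \<open>U\<^sub>n\<close>.\<close>

definition chebyshev_node :: "nat \<Rightarrow> nat \<Rightarrow> real" where
  "chebyshev_node n j = cos (real j * pi / real (Suc n))"

text \<open>
  The angles \<open>j \<pi> / (n + 1)\<close> make the right-hand side of \<open>chebyshev_poly_cos\<close> vanish, while their own
  sine does not. They lie in \<open>(0, \<pi>)\<close>, where the cosine is injective, so these are \<open>n\<close> distinct roots
  of a monic polynomial of degree \<open>n\<close>.
\<close>

lemma chebyshev_poly_factors:
  fixes v :: "'a :: real_field"
  assumes "v \<noteq> 0"
  shows "chebyshev_poly v n = (\<Prod>j\<in>{1..n}. [:- (2 * v * of_real (chebyshev_node n j)), 1:])"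
proof -
  let ?r = "\<lambda>j. 2 * v * (of_real (chebyshev_node n j) :: 'a)"
  let ?F = "\<Prod>j\<in>{1..n}. [:- ?r j, 1:]"
  have angle: "0 < real j * pi / real (Suc n)" "real j * pi / real (Suc n) < pi" if "j \<in> {1..n}" for j
  proof -
    have "real j * pi < real (Suc n) * pi"
      using that by (intro mult_strict_right_mono) auto
    then show "real j * pi / real (Suc n) < pi"
      by (simp add: pos_divide_less_eq mult.commute)
    show "0 < real j * pi / real (Suc n)" using that by simp
  qed
  have inj: "inj_on ?r {1..n}"
  proof (rule inj_onI)
    fix i j assume ij: "i \<in> {1..n}" "j \<in> {1..n}" "?r i = ?r j"
    then have "cos (real i * pi / real (Suc n)) = cos (real j * pi / real (Suc n))"
      using assms by (simp add: chebyshev_node_def)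
    then have "real i * pi / real (Suc n) = real j * pi / real (Suc n)"
      using angle[OF ij(1)] angle[OF ij(2)] by (metis cos_inj_pi less_imp_le)
    then show "i = j" by simp
  qed
  have degF: "degree ?F = n"
    by (subst degree_prod_eq_sum_degree) auto
  have "lead_coeff ?F = 1"
    by (simp add: lead_coeff_prod)
  then have coeffF: "coeff ?F n = 1"
    unfolding degF .
  show ?thesis
  proof (rule poly_eqI_degree_lead_coeff[where A = "?r ` {1..n}" and n = n])
    show "coeff (chebyshev_poly v n) n = coeff ?F n" "degree (chebyshev_poly v n) \<le> n"
      using chebyshev_poly_monic[of v n] coeffF by auto
    show "n \<le> card (?r ` {1..n})" by (simp only: card_image[OF inj]) simp
    show "degree ?F \<le> n" by (simp only: degF)
    fix z assume "z \<in> ?r ` {1..n}"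
    then obtain j where j: "j \<in> {1..n}" "z = ?r j" by blast
    let ?t = "real j * pi / real (Suc n)"
    have "real (Suc n) * ?t = real j * pi"
      by (rule nonzero_mult_div_cancel_left[of "real (Suc n)", folded times_divide_eq_right]) simp
    then have "sin (real (Suc n) * ?t) = 0"
      by (simp only: sin_npi)
    then have "poly (chebyshev_poly v n) z * of_real (sin ?t) = 0"
      unfolding j(2) chebyshev_node_def chebyshev_poly_cos by (simp only: of_real_0 mult_zero_right)
    moreover have "sin ?t \<noteq> 0"
      using sin_gt_zero[OF angle[OF j(1)]] by linarith
    ultimately have "poly (chebyshev_poly v n) z = 0"
      by (simp only: mult_eq_0_iff of_real_eq_0_iff) blast
    moreover have "poly ?F z = 0"
      unfolding poly_prod
      by (rule prod_zero[OF finite_atLeastAtMost], rule bexI[OF _ j(1)]) (simp add: j(2))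
    ultimately show "poly (chebyshev_poly v n) z = poly ?F z"
      by (simp only:)
  qed
qed

lemma chebyshev_recurrence_solution:
  fixes g :: "nat \<Rightarrow> 'a :: real_field"
  assumes "g 0 = 1" "g 1 = u" "\<And>n. g (Suc (Suc n)) = u * g (Suc n) - v\<^sup>2 * g n"
  shows "g n = (\<Prod>j\<in>{1..n}. u - 2 * v * of_real (chebyshev_node n j))"
proof (cases "v = 0")
  \<comment> \<open>For \<open>v = 0\<close> all roots coincide, so that counting distinct roots does not apply.\<close>
  case True
  have "g n = u ^ n \<and> g (Suc n) = u ^ Suc n"
    by (induction n) (use assms True in auto)
  then show ?thesis using True by simp
next
  case False
  have "g n = poly (chebyshev_poly v n) u \<and> g (Suc n) = poly (chebyshev_poly v (Suc n)) u"
    by (induction n) (use assms in auto)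
  then show ?thesis
    by (simp add: chebyshev_poly_factors[OF False] poly_prod)
qed

section \<open>Counting summands\<close>

context
  fixes f a :: "nat \<Rightarrow> nat"
  assumes fseq: "is_f_sequence f a"
begin

lemma f_sequence_0: "a 0 = 1"
  and f_sequence_Suc: "a (Suc n) = a n + (if f n \<le> n then a (n - f n) else 1)"
  using fseq unfolding is_f_sequence_iff_recurrence by auto

lemma num_summands_eq_card:
  assumes "f_decomposition f a x S"
  shows "num_summands f a x = card S"
proof -
  have "\<exists>!S. f_decomposition f a x S"
  proof (cases "x = 0")
    case True
    then show ?thesis
      using f_decomposition_zero_iff[of a f] fseq by (auto simp: is_f_sequence_def)
  next
    case False
    then show ?thesis using fseq by (auto simp: is_f_sequence_def)
  qed
  then show ?thesis
    using assms unfolding num_summands_def by (metis the_equality)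
qed

lemma num_summands_0: "num_summands f a 0 = 0"
  using num_summands_eq_card[of 0 "{}"] by (simp add: f_decomposition_def)

text \<open>
  The greedy step: the numbers in \<open>{a n..<a (Suc n)}\<close> are those whose largest index is \<open>n\<close>, and
  what remains after removing \<open>a n\<close> uses only indices below \<open>n - f n\<close>.
\<close>

lemma num_summands_add_leading:
  assumes "y < (if f n \<le> n then a (n - f n) else 1)"
  shows "num_summands f a (a n + y) = Suc (num_summands f a y)"
proof -
  have "y < a (n - f n)"
    using assms f_sequence_0 by (auto split: if_splits)
  then obtain S where S: "S \<subseteq> {..<n - f n}" "f_decomposition f a y S"
    using f_decompositions_below[OF f_sequence_0 f_sequence_Suc] by blast
  then have "\<forall>m\<in>S. m + f n < n" by auto
  from f_decomposition_insert[OF S(2) this]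
  have "num_summands f a (a n + y) = card (insert n S)"
    by (rule num_summands_eq_card)
  moreover have "n \<notin> S" "finite S"
    using S by (auto simp: f_decomposition_def)
  ultimately show ?thesis
    using num_summands_eq_card[OF S(2)] by simp
qed

definition summand_gf :: "'c :: comm_ring_1 \<Rightarrow> nat \<Rightarrow> 'c" where
  "summand_gf z n = (\<Sum>x<a n. z ^ num_summands f a x)"

lemma summand_gf_0: "summand_gf z 0 = 1"
  by (simp add: summand_gf_def f_sequence_0 num_summands_0)

lemma summand_gf_Suc:
  "summand_gf z (Suc n) = summand_gf z n + z * (if f n \<le> n then summand_gf z (n - f n) else 1)"
proof -
  define c where "c = (if f n \<le> n then a (n - f n) else 1)"
  have "summand_gf z (Suc n) = (\<Sum>x<a n + c. z ^ num_summands f a x)"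
    by (simp add: summand_gf_def f_sequence_Suc c_def)
  also have "\<dots> = summand_gf z n + (\<Sum>y<c. z ^ num_summands f a (a n + y))"
    using sum.atLeastLessThan_concat[of 0 "a n" "a n + c" "\<lambda>x. z ^ num_summands f a x"]
      sum.shift_bounds_nat_ivl[of "\<lambda>x. z ^ num_summands f a x" 0 "a n" c]
    by (simp add: summand_gf_def lessThan_atLeast0 add.commute)
  also have "(\<Sum>y<c. z ^ num_summands f a (a n + y)) = z * (\<Sum>y<c. z ^ num_summands f a y)"
    unfolding sum_distrib_left
    by (rule sum.cong) (simp_all add: c_def num_summands_add_leading)
  also have "(\<Sum>y<c. z ^ num_summands f a y) = (if f n \<le> n then summand_gf z (n - f n) else 1)"
    by (simp add: c_def summand_gf_def num_summands_0)
  finally show ?thesis .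
qed

end

section \<open>Bins\<close>

context
  fixes b :: nat and a :: "nat \<Rightarrow> nat"
  assumes b: "2 \<le> b" and bseq: "is_f_sequence (bin_fun b) a"
begin

abbreviation bin_gf :: "'c :: comm_ring_1 \<Rightarrow> nat \<Rightarrow> 'c" where
  "bin_gf \<equiv> summand_gf (bin_fun b) a"

text \<open>Every index of a bin above the lowest one excludes all lower indices of its bin, and so each
  contributes \<open>z\<close> times the same generating function, that of the numbers using earlier bins only.\<close>

lemma bin_gf_inside_bin:
  assumes "r \<le> b - 1"
  shows "bin_gf z (b * k + 1 + r) = bin_gf z (b * k + 1) + of_nat r * z * bin_gf z (b * k)"
  using assms
proof (induction r)
  case (Suc r)
  then have "bin_fun b (b * k + 1 + r) = 1 + r"
    using b mod_mult_self4[of b k "1 + r"] by (simp add: bin_fun_def)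
  then have "bin_gf z (Suc (b * k + 1 + r)) = bin_gf z (b * k + 1 + r) + z * bin_gf z (b * k)"
    by (subst summand_gf_Suc[OF bseq]) simp
  then show ?case
    using Suc by (simp add: algebra_simps)
qed simp

text \<open>
  Choosing any of the \<open>b\<close> indices of the last bin, or none, would give the factor \<open>1 + b z\<close>. What has
  to be subtracted are the choices of both the bottom of the last bin and the top of the bin
  before it; as the top index is compatible with everything in earlier bins, they contribute
  \<open>z\<^sup>2\<close> times the generating function for two bins fewer.
\<close>

lemma bin_gf_recurrence:
  fixes z :: "'c :: comm_ring_1"
  shows "bin_gf z (b * 0) = 1"
    and "bin_gf z (b * 1) = 1 + of_nat b * z"
    and "bin_gf z (b * Suc (Suc k)) = (1 + of_nat b * z) * bin_gf z (b * Suc k) - z\<^sup>2 * bin_gf z (b * k)"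
proof -
  have ob: "(of_nat (b - 1) :: 'c) = of_nat b - 1"
    using b by simp
  have full: "bin_gf z (b * Suc k) = bin_gf z (b * k + 1) + of_nat (b - 1) * z * bin_gf z (b * k)" for k
    using bin_gf_inside_bin[of "b - 1" z k] b by (simp add: add.commute)
  have bottom: "bin_fun b (b * k) = 1" for k
    by (simp add: bin_fun_def)
  show 0: "bin_gf z (b * 0) = 1"
    by (simp add: summand_gf_0[OF bseq])
  have "bin_gf z (Suc 0) = 1 + z"
    using summand_gf_Suc[OF bseq, of z 0] bottom[of 0] by (simp add: summand_gf_0[OF bseq])
  then show "bin_gf z (b * 1) = 1 + of_nat b * z"
    using full[of 0, unfolded ob] 0 by (simp add: algebra_simps)
  \<comment> \<open>The bottom of a bin excludes the top of the preceding bin, index \<open>b * Suc k - 1\<close>, and nothing else.\<close>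
  have "1 \<le> b * Suc k" using b by simp
  then have carry: "bin_gf z (b * Suc k + 1) = bin_gf z (b * Suc k) + z * bin_gf z (b * Suc k - 1)"
    using summand_gf_Suc[OF bseq, of z "b * Suc k"] bottom[of "Suc k"] by simp
  have top_free: "bin_gf z (b * Suc k - 1) = bin_gf z (b * Suc k) - z * bin_gf z (b * k)"
  proof -
    have "b * Suc k - 1 = b * k + 1 + (b - 2)" using b by simp
    then have "bin_gf z (b * Suc k - 1) = bin_gf z (b * k + 1) + of_nat (b - 2) * z * bin_gf z (b * k)"
      using bin_gf_inside_bin[of "b - 2" z k] by simp
    moreover have "(of_nat (b - 2) :: 'c) = of_nat b - 2"
      using b by simp
    ultimately show ?thesis
      unfolding full ob by (simp add: algebra_simps)
  qed
  show "bin_gf z (b * Suc (Suc k)) =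
      (1 + of_nat b * z) * bin_gf z (b * Suc k) - z\<^sup>2 * bin_gf z (b * k)"
    unfolding full[of "Suc k"] ob carry top_free by (simp add: algebra_simps power2_eq_square)
qed

lemma bin_gf_factors:
  fixes z :: "'c :: real_field"
  shows "bin_gf z (b * n) = (\<Prod>j\<in>{1..n}. 1 + of_real (real b - 2 * chebyshev_node n j) * z)"
proof -
  have "bin_gf z (b * n) = (\<Prod>j\<in>{1..n}. (1 + of_nat b * z) - 2 * z * of_real (chebyshev_node n j))"
    by (rule chebyshev_recurrence_solution[where g = "\<lambda>n. bin_gf z (b * n)"])
      (rule bin_gf_recurrence)+
  then show ?thesis by (simp add: algebra_simps)
qed

end

theorem theorem1p9:
  fixes b :: nat and a :: "nat \<Rightarrow> nat"
  assumes "b \<ge> 3" and "is_f_sequence (bin_fun b) a"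
  shows "weak_conv_m
    (\<lambda>n. let P = pmf_of_set {0..<a (b * n)};
             X = (\<lambda>x. real (num_summands (bin_fun b) a x))
         in distr (measure_pmf P) borel (standardized P X))
    std_normal_distribution"
proof -
  define c where "c = (\<lambda>n j. real b - 2 * chebyshev_node n j)"
  define p where "p = (\<lambda>n j. c n j / (1 + c n j))"
  have c: "1 \<le> c n j" "c n j \<le> real b + 2" for n j
    using assms(1) cos_le_one[of "real j * pi / real (Suc n)"]
      cos_ge_minus_one[of "real j * pi / real (Suc n)"]
    unfolding c_def chebyshev_node_def by linarith+
  have b2: "2 \<le> b" using assms(1) by simp
  have gf: "(\<Sum>x\<in>{0..<a (b * n)}. z ^ num_summands (bin_fun b) a x) = (\<Prod>j\<in>{1..n}. 1 + of_real (c n j) * z)"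
    for z :: complex and n
    using bin_gf_factors[OF b2 assms(2), of z n]
    by (simp add: summand_gf_def[OF assms(2)] c_def lessThan_atLeast0)
  have pb: "poisson_binomial (pmf_of_set {0..<a (b * n)}) (num_summands (bin_fun b) a) {1..n} (p n)" for n
  proof
    have pos: "0 < a (b * n)"
      using assms(2) by (simp add: is_f_sequence_def)
    then have ne: "{0..<a (b * n)} \<noteq> {}" by simp
    show "finite (set_pmf (pmf_of_set {0..<a (b * n)}))"
      using ne by simp
    show "finite {1..n}" by simp
    show "0 \<le> p n j \<and> p n j \<le> 1" for j
      using c(1)[of n j] by (simp add: p_def)
    fix z :: complex
    have total: "of_nat (a (b * n)) = (\<Prod>j\<in>{1..n}. 1 + complex_of_real (c n j))"
      using gf[where z = 1 and n = n] by simp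
    have "measure_pmf.expectation (pmf_of_set {0..<a (b * n)}) (\<lambda>x. z ^ num_summands (bin_fun b) a x) =
        (\<Prod>j\<in>{1..n}. 1 + of_real (c n j) * z) / of_nat (a (b * n))"
      unfolding gf[symmetric] using ne
      by (subst integral_measure_pmf[of "{0..<a (b * n)}"])
        (auto simp: sum_divide_distrib indicator_def scaleR_sum_right[symmetric] scaleR_conv_of_real)
    also have "\<dots> = (\<Prod>j\<in>{1..n}. 1 - of_real (p n j) + of_real (p n j) * z)"
      unfolding total prod_dividef[symmetric]
    proof (rule prod.cong[OF refl])
      fix j
      have nz: "1 + complex_of_real (c n j) \<noteq> 0"
        using c(1)[of n j] by (simp add: complex_eq_iff)
      have p: "complex_of_real (p n j) = of_real (c n j) / (1 + of_real (c n j))"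
        by (simp add: p_def)
      show "(1 + of_real (c n j) * z) / (1 + of_real (c n j)) = 1 - of_real (p n j) + of_real (p n j) * z"
        unfolding p using nz by (simp add: field_simps)
    qed
    finally show "measure_pmf.expectation (pmf_of_set {0..<a (b * n)})
        (\<lambda>x. z ^ num_summands (bin_fun b) a x) = \<dots>" .
  qed
  have var_ge: "1 / (real b + 3)\<^sup>2 \<le> p n j * (1 - p n j)" for n j
  proof -
    have "p n j * (1 - p n j) = c n j / (1 + c n j)\<^sup>2"
      using c(1)[of n j] by (simp add: p_def field_simps power2_eq_square)
    moreover have "1 / (real b + 3)\<^sup>2 \<le> c n j / (1 + c n j)\<^sup>2"
      using c[of n j] by (intro frac_le power_mono) auto
    ultimately show ?thesis by simp
  qed
  have "filterlim (\<lambda>n. \<Sum>j\<in>{1..n}. p n j * (1 - p n j)) at_top sequentially"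
  proof (rule filterlim_at_top_mono)
    show "filterlim (\<lambda>n. real n * (1 / (real b + 3)\<^sup>2)) at_top sequentially"
      by (intro filterlim_at_top_mult_tendsto_pos[OF tendsto_const] filterlim_real_sequentially) simp
    have "real n * (1 / (real b + 3)\<^sup>2) \<le> (\<Sum>j\<in>{1..n}. p n j * (1 - p n j))" for n
      using sum_bounded_below[of "{1..n}", OF var_ge] by simp
    then show "eventually (\<lambda>n. real n * (1 / (real b + 3)\<^sup>2) \<le>
        (\<Sum>j\<in>{1..n}. p n j * (1 - p n j))) sequentially"
      by (intro always_eventually allI)
  qed
  from poisson_binomial_clt[OF pb this] show ?thesis
    by (simp add: Let_def)
qed

end
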